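(* Let $X=\{\lambda_i\}$ be a finite set, let $\mathbb{Z}X$ be the free Abelian group (written multiplicatively) on $X$, and consider a short exact sequence of groups $$1\longrightarrow \mathbb{Z}X\longrightarrow G\stackrel{\pi}{\longrightarrow} S_n\longrightarrow 1$$ in which the action of $S_n$ on $\mathbb{Z}X$ induced by conjugation in $G$ is a faithful permutation representation (i.e. it is faithful and permutes the basis $X$). Let $\alpha\in G$ be an element of order $t$. Let $\theta=\pi(\alpha)^{-1}$ and let $T_\theta\subseteq X$ be a transversal of the action of $\alpha$ on $X$. For integers $a_i$ (one for each $\lambda_i\in X$), the element $\prod_{\lambda_i\in X}\lambda_i^{a_i}\,\alpha$ has order $t$ in $G$ if and only if $$\sum_{\lambda_r\in\mathcal{O}_\theta(\lambda_{i_j})}a_r=0\quad\text{for all }\lambda_{i_j}\in T_\theta .$$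
   Context: For $g\in G$ with $\varphi=\pi(g)^{-1}$, write $g\lambda_i g^{-1}=\lambda_{\varphi(i)}$ for the action on the basis $X$. "The action of $\alpha$ on $X$" means the action by conjugation of the cyclic group generated by $\alpha$; $\mathcal{O}_\theta(\lambda_i)=\{\lambda_{\theta^k(i)}\mid k\in\mathbb{Z}\}$ is the orbit of $\lambda_i$ under this action, where $\theta=\pi(\alpha)^{-1}$, and a transversal is a set of representatives, one for each orbit. *)

theory Defs
  imports
    "HOL-Algebra.Free_Abelian_Groups" "HOL-Algebra.Group_Action" "HOL-Algebra.Sym_Groups"
    "HOL-Algebra.Exact_Sequence" "HOL-Algebra.Multiplicative_Group"
begin

text \<open>The library's \<^const>\<open>short_exact_sequence\<close> forces the three groups to have the same
  element type, so its characterisation is restated here for three different types.\<close>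

definition short_exact ::
  "('n, 'a) monoid_scheme \<Rightarrow> ('g, 'b) monoid_scheme \<Rightarrow> ('h, 'c) monoid_scheme \<Rightarrow>
    ('n \<Rightarrow> 'g) \<Rightarrow> ('g \<Rightarrow> 'h) \<Rightarrow> bool"
  where "short_exact N G H f p \<longleftrightarrow>
    group N \<and> group G \<and> group H \<and> f \<in> mon N G \<and> p \<in> epi G H \<and> kernel G H p = f ` carrier N"

text \<open>The action of the quotient on an abelian kernel: \<open>\<sigma>\<close> sends \<open>v\<close> to \<open>g v g\<inverse>\<close> for any
  \<open>g\<close> with \<open>p g = \<sigma>\<close>. Outside the carrier of the kernel the value is \<open>undefined\<close>, as
  \<^const>\<open>BijGroup\<close> requires.\<close>

definition induced_action ::
  "('n, 'a) monoid_scheme \<Rightarrow> ('g, 'b) monoid_scheme \<Rightarrow>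
    ('n \<Rightarrow> 'g) \<Rightarrow> ('g \<Rightarrow> 'h) \<Rightarrow> 'h \<Rightarrow> 'n \<Rightarrow> 'n"
  where "induced_action N G f p \<sigma> = (\<lambda>v\<in>carrier N.
    THE w. w \<in> carrier N \<and>
      (\<exists>g\<in>carrier G. p g = \<sigma> \<and> f w = g \<otimes>\<^bsub>G\<^esub> f v \<otimes>\<^bsub>G\<^esub> inv\<^bsub>G\<^esub> g))"

definition faithful_permutation_rep ::
  "'x set \<Rightarrow> ('h, 'c) monoid_scheme \<Rightarrow> ('h \<Rightarrow> ('x \<Rightarrow>\<^sub>0 int) \<Rightarrow> ('x \<Rightarrow>\<^sub>0 int)) \<Rightarrow> bool"
  where "faithful_permutation_rep X H act \<longleftrightarrow>
    faithful_action H (carrier (free_Abelian_group X)) act \<and>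
    (\<forall>\<sigma>\<in>carrier H. act \<sigma> ` frag_of ` X = frag_of ` X)"

text \<open>The index \<open>\<sigma>(i)\<close>. The convention is \<open>g \<lambda>\<^sub>i g\<inverse> = \<lambda>\<^bsub>\<phi>(i)\<^esub>\<close> with \<open>\<phi> = \<pi>(g)\<inverse>\<close> (see
  \<open>basis_index_conj\<close> below), so \<open>\<sigma>\<close> moves indices by the action of \<open>\<sigma>\<inverse>\<close>; this makes
  \<open>i \<mapsto> \<sigma>(i)\<close> a right action.\<close>

definition basis_index ::
  "'x set \<Rightarrow> ('h, 'c) monoid_scheme \<Rightarrow> ('h \<Rightarrow> ('x \<Rightarrow>\<^sub>0 int) \<Rightarrow> ('x \<Rightarrow>\<^sub>0 int)) \<Rightarrow> 'h \<Rightarrow> 'x \<Rightarrow> 'x"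
  where "basis_index X H act \<sigma> i = (THE j. j \<in> X \<and> act (inv\<^bsub>H\<^esub> \<sigma>) (frag_of i) = frag_of j)"

definition index_orbit ::
  "'x set \<Rightarrow> ('h, 'c) monoid_scheme \<Rightarrow> ('h \<Rightarrow> ('x \<Rightarrow>\<^sub>0 int) \<Rightarrow> ('x \<Rightarrow>\<^sub>0 int)) \<Rightarrow> 'h \<Rightarrow> 'x \<Rightarrow> 'x set"
  where "index_orbit X H act \<theta> i = {basis_index X H act (\<theta> [^]\<^bsub>H\<^esub> k) i | k :: int. True}"

definition is_transversal :: "'x set \<Rightarrow> ('x \<Rightarrow> 'x set) \<Rightarrow> 'x set \<Rightarrow> bool"
  where "is_transversal X orb T \<longleftrightarrow> T \<subseteq> X \<and> (\<forall>Q \<in> orb ` X. \<exists>!j. j \<in> T \<inter> Q)"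

lemma induced_action_conj:
  assumes ex: "short_exact N G H f p" and N: "comm_group N"
    and g: "g \<in> carrier G" and v: "v \<in> carrier N"
  shows "induced_action N G f p (p g) v \<in> carrier N"
    and "f (induced_action N G f p (p g) v) = g \<otimes>\<^bsub>G\<^esub> f v \<otimes>\<^bsub>G\<^esub> inv\<^bsub>G\<^esub> g"
proof -
  interpret G: group G using ex by (simp add: short_exact_def)
  interpret N: comm_group N by (rule N)
  interpret p: group_hom G H p
    using ex by (simp add: short_exact_def group_hom_def group_hom_axioms_def epi_def)
  interpret f: group_hom N G f
    using ex by (simp add: short_exact_def group_hom_def group_hom_axioms_def mon_def)
  have ker: "kernel G H p = f ` carrier N" and inj: "inj_on f (carrier N)"
    using ex by (auto simp: short_exact_def mon_def)
  have fker: "p (f u) = \<one>\<^bsub>H\<^esub>" if "u \<in> carrier N" for u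
    using ker that by (auto simp: kernel_def)
  have "g \<otimes>\<^bsub>G\<^esub> f v \<otimes>\<^bsub>G\<^esub> inv\<^bsub>G\<^esub> g \<in> kernel G H p"
    using g v fker by (simp add: kernel_def)
  then obtain w where w: "w \<in> carrier N" "f w = g \<otimes>\<^bsub>G\<^esub> f v \<otimes>\<^bsub>G\<^esub> inv\<^bsub>G\<^esub> g"
    using ker by auto
  have indep: "h \<otimes>\<^bsub>G\<^esub> f v \<otimes>\<^bsub>G\<^esub> inv\<^bsub>G\<^esub> h = g \<otimes>\<^bsub>G\<^esub> f v \<otimes>\<^bsub>G\<^esub> inv\<^bsub>G\<^esub> g"
    if h: "h \<in> carrier G" "p h = p g" for h
  proof -
    have "inv\<^bsub>G\<^esub> g \<otimes>\<^bsub>G\<^esub> h \<in> kernel G H p"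
      using g h by (simp add: kernel_def)
    then obtain u where u: "u \<in> carrier N" "f u = inv\<^bsub>G\<^esub> g \<otimes>\<^bsub>G\<^esub> h"
      using ker by (metis image_iff)
    have hu: "h = g \<otimes>\<^bsub>G\<^esub> f u"
      using g h(1) by (simp add: u(2) G.m_assoc[symmetric])
    have "f u \<otimes>\<^bsub>G\<^esub> f v = f v \<otimes>\<^bsub>G\<^esub> f u"
      using u(1) v by (metis f.hom_mult N.m_comm)
    then have "h \<otimes>\<^bsub>G\<^esub> f v = g \<otimes>\<^bsub>G\<^esub> f v \<otimes>\<^bsub>G\<^esub> f u"
      using g u(1) v by (simp add: hu G.m_assoc)
    then show ?thesis
      using g u(1) v by (simp add: hu G.inv_mult_group G.m_assoc[symmetric])
        (simp add: G.m_assoc)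
  qed
  have "(THE w. w \<in> carrier N \<and>
      (\<exists>h\<in>carrier G. p h = p g \<and> f w = h \<otimes>\<^bsub>G\<^esub> f v \<otimes>\<^bsub>G\<^esub> inv\<^bsub>G\<^esub> h)) = w"
  proof (rule the_equality)
    show "w \<in> carrier N \<and> (\<exists>h\<in>carrier G. p h = p g \<and> f w = h \<otimes>\<^bsub>G\<^esub> f v \<otimes>\<^bsub>G\<^esub> inv\<^bsub>G\<^esub> h)"
      using w g by blast
    show "w' = w" if "w' \<in> carrier N \<and>
        (\<exists>h\<in>carrier G. p h = p g \<and> f w' = h \<otimes>\<^bsub>G\<^esub> f v \<otimes>\<^bsub>G\<^esub> inv\<^bsub>G\<^esub> h)" for w'
      using that indep w inj by (metis inj_onD)
  qed
  then have "induced_action N G f p (p g) v = w"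
    using v by (simp add: induced_action_def)
  with w show "induced_action N G f p (p g) v \<in> carrier N"
    and "f (induced_action N G f p (p g) v) = g \<otimes>\<^bsub>G\<^esub> f v \<otimes>\<^bsub>G\<^esub> inv\<^bsub>G\<^esub> g"
    by simp_all
qed

lemma induced_action_group_action:
  assumes ex: "short_exact N G H f p" and N: "comm_group N"
  shows "group_action H (carrier N) (induced_action N G f p)"
proof -
  let ?act = "induced_action N G f p"
  interpret G: group G using ex by (simp add: short_exact_def)
  interpret p: group_hom G H p
    using ex by (simp add: short_exact_def group_hom_def group_hom_axioms_def epi_def)
  interpret f: group_hom N G f
    using ex by (simp add: short_exact_def group_hom_def group_hom_axioms_def mon_def)
  have inj: "inj_on f (carrier N)" and surj: "p ` carrier G = carrier H"
    using ex by (auto simp: short_exact_def mon_def epi_def)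
  note conj = induced_action_conj[OF ex N]
  have mult: "?act (p (g \<otimes>\<^bsub>G\<^esub> h)) v = ?act (p g) (?act (p h) v)"
    if "g \<in> carrier G" "h \<in> carrier G" "v \<in> carrier N" for g h v
    by (rule inj_onD[OF inj])
      (use that in \<open>simp_all add: conj G.m_assoc G.inv_mult_group del: p.hom_mult\<close>)
  have one: "?act (p \<one>\<^bsub>G\<^esub>) v = v" if "v \<in> carrier N" for v
    by (rule inj_onD[OF inj]) (use that in \<open>simp_all add: conj del: p.hom_one\<close>)
  have cancel: "?act (p (inv\<^bsub>G\<^esub> g)) (?act (p g) v) = v" "?act (p g) (?act (p (inv\<^bsub>G\<^esub> g)) v) = v"
    if "g \<in> carrier G" "v \<in> carrier N" for g v
    using that mult[of "inv\<^bsub>G\<^esub> g" g v] mult[of g "inv\<^bsub>G\<^esub> g" v] one[of v] by simp_all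
  have bij: "?act (p g) \<in> Bij (carrier N)" if "g \<in> carrier G" for g
  proof -
    have "bij_betw (?act (p g)) (carrier N) (carrier N)"
      by (rule bij_betw_byWitness[where f' = "?act (p (inv\<^bsub>G\<^esub> g))"])
        (use that cancel conj(1) in \<open>auto simp del: p.hom_inv\<close>)
    then show ?thesis by (simp add: Bij_def induced_action_def)
  qed
  have "?act (p g \<otimes>\<^bsub>H\<^esub> p h) = compose (carrier N) (?act (p g)) (?act (p h))"
    if "g \<in> carrier G" "h \<in> carrier G" for g h
  proof (rule extensionalityI[where A = "carrier N"])
    show "?act (p g \<otimes>\<^bsub>H\<^esub> p h) \<in> extensional (carrier N)" by (simp add: induced_action_def)
    show "compose (carrier N) (?act (p g)) (?act (p h)) \<in> extensional (carrier N)" by simp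
    show "?act (p g \<otimes>\<^bsub>H\<^esub> p h) v = compose (carrier N) (?act (p g)) (?act (p h)) v"
      if v: "v \<in> carrier N" for v
      using mult[OF \<open>g \<in> carrier G\<close> \<open>h \<in> carrier G\<close> v] that \<open>g \<in> carrier G\<close> \<open>h \<in> carrier G\<close>
      by (simp add: compose_def)
  qed
  then have "?act \<in> hom H (BijGroup (carrier N))"
    using bij by (auto simp: hom_def BijGroup_def surj[symmetric])
  then show ?thesis
    by (simp add: group_action_def group_hom_def group_hom_axioms_def group_BijGroup)
qed

lemma basis_index_conj:
  assumes ex: "short_exact (free_Abelian_group X) G H f p"
    and rep: "faithful_permutation_rep X H (induced_action (free_Abelian_group X) G f p)"
    and g: "g \<in> carrier G" and i: "i \<in> X"
  defines "j \<equiv> basis_index X H (induced_action (free_Abelian_group X) G f p) (inv\<^bsub>H\<^esub> (p g)) i"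
  shows "j \<in> X" and "g \<otimes>\<^bsub>G\<^esub> f (frag_of i) \<otimes>\<^bsub>G\<^esub> inv\<^bsub>G\<^esub> g = f (frag_of j)"
proof -
  let ?act = "induced_action (free_Abelian_group X) G f p"
  interpret p: group_hom G H p
    using ex by (simp add: short_exact_def group_hom_def group_hom_axioms_def epi_def)
  have pg: "p g \<in> carrier H" using g by simp
  have "?act (p g) (frag_of i) \<in> frag_of ` X"
    using rep pg i unfolding faithful_permutation_rep_def by blast
  then obtain k where k: "k \<in> X" "?act (p g) (frag_of i) = frag_of k" by blast
  have "j = k"
    unfolding j_def basis_index_def using k pg by (intro the_equality) (auto simp: frag_of_eq)
  moreover have "f (?act (p g) (frag_of i)) = g \<otimes>\<^bsub>G\<^esub> f (frag_of i) \<otimes>\<^bsub>G\<^esub> inv\<^bsub>G\<^esub> g"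
    using ex g i by (intro induced_action_conj(2) abelian_free_Abelian_group) auto
  ultimately show "j \<in> X" "g \<otimes>\<^bsub>G\<^esub> f (frag_of i) \<otimes>\<^bsub>G\<^esub> inv\<^bsub>G\<^esub> g = f (frag_of j)"
    using k by auto
qed

end

theory Submission
  imports Defs
begin

text \<open>Write the free abelian group additively and let \<open>g\<close> act on it by conjugation, so that
  \<open>g v g\<inverse>\<close> is the vector \<open>g \<cdot> v\<close>. Moving all powers of \<open>g\<close> to the right gives
  \<open>(v g)\<^sup>m = (v + g \<cdot> v + \<dots> + g\<^sup>m\<^sup>-\<^sup>1 \<cdot> v) g\<^sup>m\<close>.
  Let \<open>g\<close> have finite order \<open>t\<close>, and let \<open>w\<close> be the vector \<open>v + g \<cdot> v + \<dots> + g\<^sup>t\<^sup>-\<^sup>1 \<cdot> v\<close>, so that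
  \<open>(v g)\<^sup>t = w\<close>. The proof reads off when \<open>w\<close> vanishes from two observations.

  \<^item> Conjugation by \<open>g\<close> permutes coefficients inside the orbits of \<open>g\<close> on the basis, so it preserves
    the sum of the coefficients over an orbit. Hence every orbit sum of \<open>w\<close> is \<open>t\<close> times that of \<open>v\<close>
    (\<open>pow_eq_translation\<close>).
  \<^item> As a power of \<open>v g\<close>, the vector \<open>w\<close> commutes with \<open>v g\<close>; it also commutes with \<open>v\<close>, and so
    with \<open>g\<close>. Hence its coefficients are constant on each orbit
    (\<open>lookup_constant_on_orbit\<close>).

  Together they show that the coefficient of \<open>w\<close> on an orbit, multiplied by the size of the orbit, is
  \<open>t\<close> times the orbit sum of \<open>v\<close>. So \<open>(v g)\<^sup>t = 1\<close> exactly when all orbit sums of \<open>v\<close> vanish. No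
  smaller power of \<open>v g\<close> can be trivial: if \<open>(v g)\<^sup>m = 1\<close> then \<open>g\<^sup>m\<close> is a torsion element of
  the free abelian group, hence trivial, and \<open>t\<close> divides \<open>m\<close>
  (\<open>ord_dvd_of_pow_in_image\<close>).\<close>

section \<open>Conjugation on the kernel and on the basis\<close>

lemma (in group) commutes_int_pow:
  assumes "x \<otimes> y = y \<otimes> x" and x: "x \<in> carrier G" and y: "y \<in> carrier G"
  shows "x [^] (k::int) \<otimes> y = y \<otimes> x [^] k"
proof -
  have nat: "x [^] (n::nat) \<otimes> y = y \<otimes> x [^] n" for n
    using assms by (rule group_commutes_pow)
  have neg: "inv (x [^] n) \<otimes> y = y \<otimes> inv (x [^] n)" for n :: nat
  proof -
    have "inv (x [^] n) \<otimes> y = inv (x [^] n) \<otimes> (y \<otimes> x [^] n) \<otimes> inv (x [^] n)"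
      using x y by (simp add: m_assoc)
    also have "\<dots> = inv (x [^] n) \<otimes> (x [^] n \<otimes> y) \<otimes> inv (x [^] n)"
      by (simp only: nat)
    also have "\<dots> = y \<otimes> inv (x [^] n)"
      using x y by (simp flip: m_assoc)
    finally show ?thesis .
  qed
  show ?thesis
  proof (cases k rule: int_cases2)
    case (nonneg n)
    with nat show ?thesis by (simp only: int_pow_int)
  next
    case (nonpos n)
    with neg x show ?thesis by (simp only: int_pow_neg_int)
  qed
qed

locale permutation_extension =
  fixes X :: "'x set" and G :: "('g, 'm) monoid_scheme" (structure)
    and H :: "('h, 'c) monoid_scheme"
    and f :: "('x \<Rightarrow>\<^sub>0 int) \<Rightarrow> 'g" and p :: "'g \<Rightarrow> 'h"
  assumes exact: "short_exact (free_Abelian_group X) G H f p"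
    and rep: "faithful_permutation_rep X H (induced_action (free_Abelian_group X) G f p)"
begin

abbreviation ZX :: "('x \<Rightarrow>\<^sub>0 int) monoid" where "ZX \<equiv> free_Abelian_group X"

abbreviation act :: "'h \<Rightarrow> ('x \<Rightarrow>\<^sub>0 int) \<Rightarrow> ('x \<Rightarrow>\<^sub>0 int)"
  where "act \<equiv> induced_action ZX G f p"

text \<open>The additive form of \<open>v \<mapsto> g v g\<inverse>\<close>; see \<open>f_conj_act\<close>.\<close>

definition conj_act :: "'g \<Rightarrow> ('x \<Rightarrow>\<^sub>0 int) \<Rightarrow> ('x \<Rightarrow>\<^sub>0 int)"
  where "conj_act g = act (p g)"

text \<open>The index of \<open>g \<lambda>\<^sub>i g\<inverse>\<close>; see \<open>f_index_perm\<close>. The inverse makes \<open>g \<mapsto> index_perm g\<close> a left action,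
  since \<^const>\<open>basis_index\<close> inverts its argument once more.\<close>

definition index_perm :: "'g \<Rightarrow> 'x \<Rightarrow> 'x"
  where "index_perm g = basis_index X H act (inv\<^bsub>H\<^esub> (p g))"

definition orbit_of :: "'g \<Rightarrow> 'x \<Rightarrow> 'x set"
  where "orbit_of g i = range (\<lambda>k::int. index_perm (g [^] k) i)"

sublocale G: group G
  using exact by (simp add: short_exact_def)

sublocale f: group_hom ZX G f
  using exact by (simp add: short_exact_def group_hom_def group_hom_axioms_def mon_def)

sublocale p: group_hom G H p
  using exact by (simp add: short_exact_def group_hom_def group_hom_axioms_def epi_def)

lemma inj_f: "inj_on f (carrier ZX)"
  using exact by (auto simp: short_exact_def mon_def)

lemma f_add: "u \<in> carrier ZX \<Longrightarrow> v \<in> carrier ZX \<Longrightarrow> f (u + v) = f u \<otimes> f v"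
  using f.hom_mult[of u v] by simp

lemma add_closed: "u \<in> carrier ZX \<Longrightarrow> v \<in> carrier ZX \<Longrightarrow> u + v \<in> carrier ZX"
  using f.m_closed[of u v] by simp

lemma f_eq_one_iff: "v \<in> carrier ZX \<Longrightarrow> f v = \<one> \<longleftrightarrow> v = 0"
  using inj_f f.hom_one by (metis f.G.one_closed inj_onD one_free_Abelian_group)

lemma conj_act_closed: "g \<in> carrier G \<Longrightarrow> v \<in> carrier ZX \<Longrightarrow> conj_act g v \<in> carrier ZX"
  unfolding conj_act_def by (rule induced_action_conj(1)[OF exact abelian_free_Abelian_group])

lemma f_conj_act: "g \<in> carrier G \<Longrightarrow> v \<in> carrier ZX \<Longrightarrow> f (conj_act g v) = g \<otimes> f v \<otimes> inv g"
  unfolding conj_act_def by (rule induced_action_conj(2)[OF exact abelian_free_Abelian_group])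

lemma index_perm_closed: "g \<in> carrier G \<Longrightarrow> i \<in> X \<Longrightarrow> index_perm g i \<in> X"
  unfolding index_perm_def by (rule basis_index_conj(1)[OF exact rep])

lemma f_index_perm:
  "g \<in> carrier G \<Longrightarrow> i \<in> X \<Longrightarrow> f (frag_of (index_perm g i)) = g \<otimes> f (frag_of i) \<otimes> inv g"
  unfolding index_perm_def by (rule basis_index_conj(2)[OF exact rep, symmetric])

lemma index_eqI:
  assumes "i \<in> X" "j \<in> X" "f (frag_of i) = f (frag_of j)"
  shows "i = j"
  using inj_onD[OF inj_f assms(3)] assms(1,2) by (simp add: frag_of_eq)

lemma index_perm_mult:
  assumes g: "g \<in> carrier G" and h: "h \<in> carrier G" and i: "i \<in> X"
  shows "index_perm (g \<otimes> h) i = index_perm g (index_perm h i)"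
proof (rule index_eqI)
  have "f (frag_of i) \<in> carrier G" using i by simp
  then show "f (frag_of (index_perm (g \<otimes> h) i)) = f (frag_of (index_perm g (index_perm h i)))"
    using g h i by (simp add: f_index_perm index_perm_closed G.inv_mult_group G.m_assoc)
qed (use assms in \<open>simp_all add: index_perm_closed\<close>)

lemma index_perm_one: "i \<in> X \<Longrightarrow> index_perm \<one> i = i"
  by (rule index_eqI) (simp_all add: f_index_perm index_perm_closed)

lemma index_perm_inv: "g \<in> carrier G \<Longrightarrow> i \<in> X \<Longrightarrow> index_perm (inv g) (index_perm g i) = i"
  by (simp add: index_perm_one flip: index_perm_mult)

lemma inj_index_perm: "g \<in> carrier G \<Longrightarrow> inj_on (index_perm g) X"
  by (rule inj_on_inverseI) (rule index_perm_inv)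

lemma conj_act_frag_of: "g \<in> carrier G \<Longrightarrow> i \<in> X \<Longrightarrow> conj_act g (frag_of i) = frag_of (index_perm g i)"
  by (rule inj_onD[OF inj_f])
     (simp_all add: f_conj_act f_index_perm conj_act_closed index_perm_closed del: carrier_free_Abelian_group_iff)

lemma conj_act_add:
  assumes g: "g \<in> carrier G" and u: "u \<in> carrier ZX" and v: "v \<in> carrier ZX"
  shows "conj_act g (u + v) = conj_act g u + conj_act g v"
proof (rule inj_onD[OF inj_f])
  have "f u \<in> carrier G" "f v \<in> carrier G"
    using u v by simp_all
  then have "g \<otimes> (f u \<otimes> f v) \<otimes> inv g = (g \<otimes> f u \<otimes> inv g) \<otimes> (g \<otimes> f v \<otimes> inv g)"
    using g by (simp add: G.m_assoc) (simp flip: G.m_assoc)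
  then show "f (conj_act g (u + v)) = f (conj_act g u + conj_act g v)"
    using g u v by (simp add: f_conj_act f_add add_closed conj_act_closed del: carrier_free_Abelian_group_iff)
qed (use assms in \<open>simp_all add: add_closed conj_act_closed del: carrier_free_Abelian_group_iff\<close>)

lemma conj_act_zero: "g \<in> carrier G \<Longrightarrow> conj_act g 0 = 0"
  using conj_act_add[of g 0 0] by simp

text \<open>On a basis vector this says that conjugation sends \<open>\<lambda>\<^sub>i\<close> to its permuted copy and that the
  index permutation is injective; both sides are additive in \<open>v\<close>.\<close>

lemma lookup_conj_act:
  assumes g: "g \<in> carrier G" and v: "v \<in> carrier ZX" and i: "i \<in> X"
  shows "Poly_Mapping.lookup (conj_act g v) (index_perm g i) = Poly_Mapping.lookup v i"
proof -
  have "Poly_Mapping.keys v \<subseteq> X"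
    using v by simp
  then have "v \<in> carrier ZX \<and>
      Poly_Mapping.lookup (conj_act g v) (index_perm g i) = Poly_Mapping.lookup v i"
  proof (induction v rule: frag_induction)
    case zero
    then show ?case using g by (simp add: conj_act_zero)
  next
    case (one x)
    then show ?case
      using g i inj_onD[OF inj_index_perm[OF g], of i x] by (auto simp: conj_act_frag_of)
  next
    case (diff u v)
    have uv: "u - v \<in> carrier ZX"
      using diff keys_diff[of u v] by auto
    have "conj_act g u = conj_act g (u - v) + conj_act g v"
      using conj_act_add[OF g uv, of v] diff by simp
    then show ?case
      using uv diff by (simp add: lookup_add lookup_minus del: carrier_free_Abelian_group_iff)
  qed
  then show ?thesis by blast
qed

section \<open>Orbits and orbit sums\<close>

text \<open>Every power of \<open>g\<close> fixes \<open>w\<close> under conjugation, while it moves the coefficient at \<open>i\<close> to the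
  permuted index.\<close>

lemma lookup_constant_on_orbit:
  assumes g: "g \<in> carrier G" and w: "w \<in> carrier ZX" and comm: "g \<otimes> f w = f w \<otimes> g"
    and i: "i \<in> X" and j: "j \<in> orbit_of g i"
  shows "Poly_Mapping.lookup w j = Poly_Mapping.lookup w i"
proof -
  obtain k :: int where k: "j = index_perm (g [^] k) i"
    using j by (auto simp: orbit_of_def)
  have gk: "g [^] k \<in> carrier G" "f w \<in> carrier G"
    using g w by simp_all
  have "g [^] k \<otimes> f w = f w \<otimes> g [^] k"
    using G.commutes_int_pow[OF comm g gk(2)] .
  then have "f (conj_act (g [^] k) w) = f w"
    using gk w by (simp add: f_conj_act G.m_assoc del: carrier_free_Abelian_group_iff)
  then have "conj_act (g [^] k) w = w"
    using inj_onD[OF inj_f] conj_act_closed gk w by metis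
  then show ?thesis
    using lookup_conj_act[OF gk(1) w i] k by simp
qed

lemma orbit_of_subset: "g \<in> carrier G \<Longrightarrow> i \<in> X \<Longrightarrow> orbit_of g i \<subseteq> X"
  by (auto simp: orbit_of_def index_perm_closed)

lemma self_in_orbit_of: "g \<in> carrier G \<Longrightarrow> i \<in> X \<Longrightarrow> i \<in> orbit_of g i"
  unfolding orbit_of_def by (rule range_eqI[of _ _ 0]) (simp add: index_perm_one)

lemma bij_betw_index_perm_orbit:
  assumes g: "g \<in> carrier G" and i: "i \<in> X"
  shows "bij_betw (index_perm g) (orbit_of g i) (orbit_of g i)"
proof -
  have step: "index_perm g (index_perm (g [^] k) i) = index_perm (g [^] (1 + k)) i" for k :: int
    using g i by (simp add: G.int_pow_mult index_perm_mult)
  have "index_perm g ` orbit_of g i = range (\<lambda>k::int. index_perm (g [^] (1 + k)) i)"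
    unfolding orbit_of_def by (simp only: image_image step)
  also have "\<dots> = (\<lambda>k. index_perm (g [^] k) i) ` range ((+) (1::int))"
    by (simp only: image_image)
  also have "\<dots> = orbit_of g i"
    unfolding orbit_of_def by (simp only: surj_plus)
  finally have "index_perm g ` orbit_of g i = orbit_of g i" .
  then show ?thesis
    using inj_on_subset[OF inj_index_perm[OF g] orbit_of_subset[OF g i]] by (simp add: bij_betw_def)
qed

definition orbit_sum :: "'g \<Rightarrow> ('x \<Rightarrow>\<^sub>0 int) \<Rightarrow> 'x \<Rightarrow> int"
  where "orbit_sum g v i = (\<Sum>r\<in>orbit_of g i. Poly_Mapping.lookup v r)"

text \<open>Conjugation by \<open>g\<close> moves coefficients along a permutation of the orbit.\<close>

lemma orbit_sum_conj_act:
  assumes g: "g \<in> carrier G" and v: "v \<in> carrier ZX" and i: "i \<in> X"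
  shows "orbit_sum g (conj_act g v) i = orbit_sum g v i"
proof -
  have "orbit_sum g (conj_act g v) i
      = (\<Sum>r\<in>orbit_of g i. Poly_Mapping.lookup (conj_act g v) (index_perm g r))"
    unfolding orbit_sum_def by (rule sum.reindex_bij_betw[OF bij_betw_index_perm_orbit[OF g i], symmetric])
  also have "\<dots> = orbit_sum g v i"
    unfolding orbit_sum_def
    using orbit_of_subset[OF g i] g v by (intro sum.cong) (auto intro!: lookup_conj_act)
  finally show ?thesis .
qed

section \<open>Powers of a translated element\<close>

text \<open>The witness is \<open>v + g \<cdot> v + \<dots> + g\<^sup>m\<^sup>-\<^sup>1 \<cdot> v\<close>. Its orbit sums need no explicit formula: each of
  the \<open>m\<close> summands has the same orbit sums as \<open>v\<close>.\<close>

lemma pow_eq_translation: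
  assumes g: "g \<in> carrier G" and v: "v \<in> carrier ZX"
  shows "\<exists>w\<in>carrier ZX. (f v \<otimes> g) [^] m = f w \<otimes> g [^] m \<and>
    (\<forall>i\<in>X. orbit_sum g w i = int m * orbit_sum g v i)"
proof (induction m)
  case 0
  show ?case
    using f.hom_one by (intro bexI[of _ 0]) (auto simp: orbit_sum_def simp del: f.hom_one)
next
  case (Suc m)
  then obtain w where w: "w \<in> carrier ZX" "(f v \<otimes> g) [^] m = f w \<otimes> g [^] m"
      "\<forall>i\<in>X. orbit_sum g w i = int m * orbit_sum g v i"
    by blast
  have car: "f v \<in> carrier G" "f w \<in> carrier G" "f v \<otimes> g \<in> carrier G" "g [^] m \<in> carrier G"
    using g v w(1) by simp_all
  have "(f v \<otimes> g) [^] Suc m = (f v \<otimes> g) \<otimes> (f w \<otimes> g [^] m)"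
    using car(3) w(2) G.nat_pow_Suc2 by metis
  also have "\<dots> = f (v + conj_act g w) \<otimes> g [^] Suc m"
    using g v w(1) car G.nat_pow_Suc2[OF g, of m]
    by (simp add: f_add f_conj_act conj_act_closed G.m_assoc
          del: carrier_free_Abelian_group_iff G.nat_pow_Suc)
       (simp flip: G.m_assoc)
  finally show ?case
    using g v w(1,3)
    by (intro bexI[of _ "v + conj_act g w"])
       (auto simp: orbit_sum_conj_act conj_act_closed add_closed algebra_simps
          orbit_sum_def[of _ "v + _"] lookup_add sum.distrib
          simp flip: orbit_sum_def simp del: carrier_free_Abelian_group_iff)
qed

text \<open>The hypothesis puts \<open>g\<^sup>m\<close> in the image of the free abelian group, where it is killed by the
  order of \<open>g\<close>. Torsion-freeness of that group makes it trivial.\<close>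

lemma ord_dvd_of_pow_in_image:
  assumes g: "g \<in> carrier G" and fin: "G.ord g > 0"
    and w: "w \<in> carrier ZX" and eq: "f w \<otimes> g [^] (m::nat) = \<one>"
  shows "G.ord g dvd m"
proof -
  let ?t = "G.ord g"
  have "f w = inv (g [^] m)"
    using g w eq by (intro G.inv_equality[symmetric]) simp_all
  then have "f w [^] ?t = (inv g) [^] (m * ?t)"
    using g by (simp add: G.nat_pow_inv G.nat_pow_pow)
  also have "\<dots> = \<one>"
    using g by (simp add: G.nat_pow_inv G.pow_eq_id)
  finally have "f (w [^]\<^bsub>ZX\<^esub> ?t) = \<one>"
    using w by (metis f.hom_nat_pow)
  then have "w [^]\<^bsub>ZX\<^esub> ?t = 0"
    using w f_eq_one_iff f.G.nat_pow_closed by metis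
  then have "frag_cmul (int ?t) w = 0" by simp
  then have "w = 0"
    using fin by simp
  then have "f w = \<one>"
    using f_eq_one_iff w by blast
  then have "g [^] m = \<one>"
    using eq g by simp
  then show ?thesis
    using g by (simp add: G.pow_eq_id)
qed

text \<open>A transversal is enough to detect the vanishing of all orbit sums: since \<open>w = (v g)\<^sup>t\<close> is
  constant on orbits, it vanishes at \<open>i\<close> as soon as it vanishes at a representative of the orbit
  of \<open>i\<close>.\<close>

theorem ord_translation_iff:
  assumes fin: "finite X" and g: "g \<in> carrier G" and t: "G.ord g > 0"
    and v: "v \<in> carrier ZX" and T: "is_transversal X (orbit_of g) T"
  shows "G.ord (f v \<otimes> g) = G.ord g \<longleftrightarrow> (\<forall>j\<in>T. orbit_sum g v j = 0)"
proof -
  define t where "t = G.ord g"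
  have tpos: "t > 0" and gt: "g [^] t = \<one>"
    using t g by (simp_all add: t_def)
  have fv: "f v \<in> carrier G" and car: "f v \<otimes> g \<in> carrier G"
    using g v by simp_all
  obtain w where w: "w \<in> carrier ZX" "(f v \<otimes> g) [^] t = f w \<otimes> g [^] t"
      "\<forall>i\<in>X. orbit_sum g w i = int t * orbit_sum g v i"
    using pow_eq_translation[OF g v] by blast
  have fw: "f w \<in> carrier G" using w(1) by simp
  have pow: "(f v \<otimes> g) [^] t = f w"
    using w fw gt by simp
  have TX: "T \<subseteq> X" using T by (simp add: is_transversal_def)
  have "G.ord (f v \<otimes> g) = t \<longleftrightarrow> (f v \<otimes> g) [^] t = \<one>"
  proof
    assume eq: "(f v \<otimes> g) [^] t = \<one>"
    obtain u where u: "u \<in> carrier ZX"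
        "(f v \<otimes> g) [^] G.ord (f v \<otimes> g) = f u \<otimes> g [^] G.ord (f v \<otimes> g)"
      using pow_eq_translation[OF g v] by blast
    \<comment> \<open>The reverse divisibility: the order of the product cannot drop below \<open>t\<close>.\<close>
    have "t dvd G.ord (f v \<otimes> g)"
      unfolding t_def using u car by (intro ord_dvd_of_pow_in_image[OF g t, of u]) simp_all
    then show "G.ord (f v \<otimes> g) = t"
      using eq car by (simp add: G.pow_eq_id dvd_antisym)
  qed (use car in auto)
  also have "\<dots> \<longleftrightarrow> w = 0"
    using pow w(1) f_eq_one_iff by simp
  also have "\<dots> \<longleftrightarrow> (\<forall>j\<in>T. orbit_sum g v j = 0)"
  proof
    assume "w = 0"
    then have "int t * orbit_sum g v j = 0" if "j \<in> X" for j
      using w(3) that by (auto simp: orbit_sum_def[of _ 0])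
    then show "\<forall>j\<in>T. orbit_sum g v j = 0"
      using TX tpos by auto
  next
    assume zero: "\<forall>j\<in>T. orbit_sum g v j = 0"
    \<comment> \<open>Cancelling \<open>v\<close> from the commutation of \<open>v g\<close> with its own power \<open>w\<close>.\<close>
    have "(f v \<otimes> g) \<otimes> f w = f w \<otimes> (f v \<otimes> g)"
      unfolding pow[symmetric] using G.nat_pow_Suc G.nat_pow_Suc2[OF car] by metis
    moreover have "f w \<otimes> f v = f v \<otimes> f w"
      using v w(1) by (metis f_add add.commute)
    ultimately have "f v \<otimes> (g \<otimes> f w) = f v \<otimes> (f w \<otimes> g)"
      using g fv fw by (metis G.m_assoc)
    then have comm: "g \<otimes> f w = f w \<otimes> g"
      using g fv fw by simp
    note const = lookup_constant_on_orbit[OF g w(1) comm]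
    have "Poly_Mapping.lookup w i = 0" if i: "i \<in> X" for i
    proof -
      obtain j where j: "j \<in> T" "j \<in> orbit_of g i"
        using T i by (auto simp: is_transversal_def)
      have jX: "j \<in> X" using j TX by blast
      have "orbit_sum g w j = int (card (orbit_of g j)) * Poly_Mapping.lookup w j"
        using const[OF jX] by (simp add: orbit_sum_def)
      moreover have "orbit_sum g w j = 0"
        using w(3) jX zero j by simp
      moreover have "card (orbit_of g j) \<noteq> 0"
        using finite_subset[OF orbit_of_subset[OF g jX] fin] self_in_orbit_of[OF g jX] by auto
      ultimately have "Poly_Mapping.lookup w j = 0" by simp
      then show ?thesis using const[OF i j(2)] by simp
    qed
    then show "w = 0"
      using w(1) by (intro poly_mapping_eqI) (auto simp: in_keys_iff)
  qed
  finally show ?thesis by (simp add: t_def)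
qed

section \<open>Translation to the index notation\<close>

lemma index_orbit_eq_orbit_of:
  assumes "g \<in> carrier G"
  shows "index_orbit X H act (inv\<^bsub>H\<^esub> (p g)) = orbit_of g"
proof -
  have "(inv\<^bsub>H\<^esub> (p g)) [^]\<^bsub>H\<^esub> k = inv\<^bsub>H\<^esub> (p (g [^] k))" for k :: int
    using assms by (simp add: p.hom_int_pow p.H.int_pow_inv)
  then show ?thesis
    by (auto simp: index_orbit_def orbit_of_def index_perm_def fun_eq_iff)
qed

end

lemma finprod_free_Abelian_group:
  assumes "finite A" and "\<And>i. i \<in> A \<Longrightarrow> v i \<in> carrier (free_Abelian_group S)"
  shows "finprod (free_Abelian_group S) v A = sum v A"
proof -
  interpret comm_group "free_Abelian_group S" by (rule abelian_free_Abelian_group)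
  show ?thesis
    using assms by (induction A rule: finite_induct) (auto simp: Pi_def)
qed

theorem theorem2p1:
  fixes X :: "'x set" and G :: "('g, 'm) monoid_scheme" and n t :: nat
    and \<iota> :: "('x \<Rightarrow>\<^sub>0 int) \<Rightarrow> 'g" and \<pi> :: "'g \<Rightarrow> (nat \<Rightarrow> nat)"
    and \<alpha> :: 'g and \<theta> :: "nat \<Rightarrow> nat" and T :: "'x set" and a :: "'x \<Rightarrow> int"
  defines "act \<equiv> induced_action (free_Abelian_group X) G \<iota> \<pi>"
  assumes "finite X"
    and "short_exact (free_Abelian_group X) G (sym_group n) \<iota> \<pi>"
    and "faithful_permutation_rep X (sym_group n) act"
    and "\<alpha> \<in> carrier G" and "t > 0" and "group.ord G \<alpha> = t"
    and "\<theta> = inv\<^bsub>sym_group n\<^esub> (\<pi> \<alpha>)"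
    and "is_transversal X (index_orbit X (sym_group n) act \<theta>) T"
  shows "group.ord G
      (\<iota> (finprod (free_Abelian_group X) (\<lambda>i. frag_of i [^]\<^bsub>free_Abelian_group X\<^esub> a i) X) \<otimes>\<^bsub>G\<^esub> \<alpha>) = t
    \<longleftrightarrow> (\<forall>j\<in>T. (\<Sum>r\<in>index_orbit X (sym_group n) act \<theta> j. a r) = 0)"
proof -
  interpret E: permutation_extension X G "sym_group n" \<iota> \<pi>
    using assms(3,4) unfolding act_def by unfold_locales
  define v where "v = (\<Sum>i\<in>X. frag_cmul (a i) (frag_of i))"
  have prod: "finprod (free_Abelian_group X) (\<lambda>i. frag_of i [^]\<^bsub>free_Abelian_group X\<^esub> a i) X = v"
  proof -
    have "finprod (free_Abelian_group X) (\<lambda>i. frag_of i [^]\<^bsub>free_Abelian_group X\<^esub> a i) X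
        = (\<Sum>i\<in>X. frag_of i [^]\<^bsub>free_Abelian_group X\<^esub> a i)"
      using \<open>finite X\<close>
      by (intro finprod_free_Abelian_group E.f.G.int_pow_closed) simp_all
    then show ?thesis by (simp add: v_def)
  qed
  have v: "v \<in> carrier (free_Abelian_group X)"
    unfolding v_def by (rule sum_closed_free_Abelian_group) (auto split: if_splits)
  have lookup: "Poly_Mapping.lookup v r = a r" if "r \<in> X" for r
    using that \<open>finite X\<close> by (simp add: v_def lookup_sum if_distrib cong: if_cong)
  have orb: "index_orbit X (sym_group n) act \<theta> = E.orbit_of \<alpha>"
    using E.index_orbit_eq_orbit_of[OF \<open>\<alpha> \<in> carrier G\<close>] by (simp add: assms(8) act_def)
  have sums: "E.orbit_sum \<alpha> v j = (\<Sum>r\<in>index_orbit X (sym_group n) act \<theta> j. a r)"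
    if "j \<in> X" for j
    unfolding orb E.orbit_sum_def
    using E.orbit_of_subset[OF \<open>\<alpha> \<in> carrier G\<close> that] by (intro sum.cong) (auto intro!: lookup)
  have ord: "E.G.ord (\<iota> v \<otimes>\<^bsub>G\<^esub> \<alpha>) = t \<longleftrightarrow> (\<forall>j\<in>T. E.orbit_sum \<alpha> v j = 0)"
    using E.ord_translation_iff[OF \<open>finite X\<close> \<open>\<alpha> \<in> carrier G\<close> _ v] assms(6,7,9)
    by (simp add: orb)
  have "T \<subseteq> X"
    using assms(9) by (simp add: is_transversal_def)
  then have "(\<forall>j\<in>T. E.orbit_sum \<alpha> v j = 0)
      \<longleftrightarrow> (\<forall>j\<in>T. (\<Sum>r\<in>index_orbit X (sym_group n) act \<theta> j. a r) = 0)"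
    using sums by (intro ball_cong) auto
  with ord show ?thesis
    unfolding prod by simp
qed

end
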